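(* Let $G$ be an odd cycle with vertex set $\{x_1,\ldots,x_n\}$ and let $S=K[x_1,\ldots,x_n]$ be a polynomial ring over a field $K$. Then $S/I(G)$ has a star-system of parameters.
   Context: Graphs are finite and simple; vertices are identified with the variables of $S$. The edge ideal of $G$ is $I(G)=(x_ix_j \mid \{x_i,x_j\}\in E(G))\subset S$, and $N_G(z)$ is the set of vertices adjacent to $z$. With $\mathfrak m=(x_1,\ldots,x_n)$, linear forms $f_1,\ldots,f_d\in S$ form a linear system of parameters for $S/I(G)$ if $d=\dim(S/I(G))$ and $\mathrm{rad}(I(G),f_1,\ldots,f_d)=\mathfrak m$; it is a 0-1 linear system of parameters if all coefficients of the $f_i$ lie in $\{0,1\}\subset K$. For $\{z_1,\ldots,z_d\}\subset V(G)$, a 0-1 linear system of parameters $\{f_1,\ldots,f_d\}$ of $S/I(G)$ is a star-system of parameters associated to $\{z_1,\ldots,z_d\}$ if for each $i$ one can write $f_i=z_i+\sum_{x_j\in A_i}x_j$ with $A_i\subset N_G(z_i)$. "$S/I(G)$ has a star-system of parameters" means it has one associated to some $\{z_1,\ldots,z_d\}\subset V(G)$. *)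

theory Defs
  imports
    "HOL-Algebra.Algebraic_Closure_Type"
    "HOL-Algebra.QuotRing"
    "HOL-Library.Poly_Mapping"
    "HOL-Library.Extended_Nat"
    "HOL-Library.Cardinality"
begin

section \<open>Ideals and Krull dimension\<close>

definition ideal_radical :: "('a, 'b) ring_scheme \<Rightarrow> 'a set \<Rightarrow> 'a set" where
  "ideal_radical R J = {a \<in> carrier R. \<exists>k::nat. k \<ge> 1 \<and> a [^]\<^bsub>R\<^esub> k \<in> J}"

text \<open>The supremum of the lengths of strictly increasing chains of prime ideals. A ring without
  prime ideals (the zero ring) is given dimension \<open>0\<close>, since \<^typ>\<open>enat\<close> has no negative values.\<close>

definition krull_dim :: "('a, 'b) ring_scheme \<Rightarrow> enat" where
  "krull_dim R = Sup {enat l | l. \<exists>P :: nat \<Rightarrow> 'a set.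
     (\<forall>i\<le>l. primeideal (P i) R) \<and> (\<forall>i<l. P i \<subset> P (Suc i))}"


section \<open>Polynomials in variables indexed by a type\<close>

text \<open>A monomial is a finitely supported exponent vector, and a polynomial a finitely supported
  family of coefficients indexed by monomials. For a finite type \<^typ>\<open>'v\<close> with \<open>n\<close> elements,
  \<open>poly_ring\<close> is the ring $S = K[x_1, \dots, x_n]$, seen as a ring object of \<open>HOL-Algebra\<close> whose
  carrier is the whole type.\<close>

type_synonym ('v, 'k) mpoly = "('v \<Rightarrow>\<^sub>0 nat) \<Rightarrow>\<^sub>0 'k"

abbreviation poly_ring :: "('v, 'k::field) mpoly ring" where
  "poly_ring \<equiv> ring_of_type_algebra"

definition mvar :: "'v \<Rightarrow> ('v, 'k::field) mpoly" where
  "mvar v = Poly_Mapping.single (Poly_Mapping.single v 1) 1"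

definition var_ideal :: "('v, 'k::field) mpoly set" where
  "var_ideal = Idl\<^bsub>poly_ring\<^esub> (range mvar)"

definition linear_form :: "('v::finite, 'k::field) mpoly \<Rightarrow> bool" where
  "linear_form f \<longleftrightarrow>
     (\<exists>c :: 'v \<Rightarrow> 'k. f = (\<Sum>v\<in>UNIV. Poly_Mapping.single (Poly_Mapping.single v 1) (c v)))"

definition zero_one_coeffs :: "('v, 'k::field) mpoly \<Rightarrow> bool" where
  "zero_one_coeffs f \<longleftrightarrow> (\<forall>m. Poly_Mapping.lookup f m \<in> {0, 1})"


section \<open>Graphs and edge ideals\<close>

text \<open>A graph on the vertex set \<^term>\<open>UNIV :: 'v set\<close> is given by its set of edges.\<close>

definition simple_graph :: "'v set set \<Rightarrow> bool" where
  "simple_graph E \<longleftrightarrow> (\<forall>e\<in>E. card e = 2)"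

definition nbrs :: "'v set set \<Rightarrow> 'v \<Rightarrow> 'v set" where
  "nbrs E z = {v. {z, v} \<in> E}"

definition edge_ideal :: "'v set set \<Rightarrow> ('v, 'k::field) mpoly set" where
  "edge_ideal E = Idl\<^bsub>poly_ring\<^esub> {mvar u * mvar v | u v. {u, v} \<in> E}"

definition cycle_graph :: "'v::finite set set \<Rightarrow> bool" where
  "cycle_graph E \<longleftrightarrow> CARD('v) \<ge> 3 \<and>
     (\<exists>c :: nat \<Rightarrow> 'v. bij_betw c {..<CARD('v)} UNIV \<and>
        E = {{c i, c (Suc i mod CARD('v))} | i. i < CARD('v)})"

lemma cycle_graph_imp_simple_graph:
  assumes "cycle_graph (E :: 'v::finite set set)"
  shows "simple_graph E"
  unfolding simple_graph_def
proof
  fix e assume "e \<in> E"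
  let ?n = "CARD('v)"
  from assms obtain c :: "nat \<Rightarrow> 'v" where n: "?n \<ge> 3"
    and c: "bij_betw c {..<?n} UNIV" and E: "E = {{c i, c (Suc i mod ?n)} | i. i < ?n}"
    by (auto simp: cycle_graph_def)
  from \<open>e \<in> E\<close> E obtain i where i: "i < ?n" and e: "e = {c i, c (Suc i mod ?n)}"
    by auto
  have "i \<noteq> Suc i mod ?n"
    using i n by (cases "Suc i = ?n") auto
  moreover have "Suc i mod ?n < ?n"
    using n by simp
  ultimately have "c i \<noteq> c (Suc i mod ?n)"
    using c i by (auto simp: bij_betw_def dest: inj_onD)
  then show "card e = 2"
    using e by simp
qed


section \<open>Linear systems of parameters\<close>

text \<open>The forms $f_1, \dots, f_d$ are indexed as \<open>f 0, \<dots>, f (d - 1)\<close>.\<close>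

definition linear_sop ::
  "('v::finite, 'k::field) mpoly set \<Rightarrow> nat \<Rightarrow> (nat \<Rightarrow> ('v, 'k) mpoly) \<Rightarrow> bool" where
  "linear_sop I d f \<longleftrightarrow>
     (\<forall>i<d. linear_form (f i)) \<and>
     krull_dim (poly_ring Quot I) = enat d \<and>
     ideal_radical poly_ring (Idl\<^bsub>poly_ring\<^esub> (I \<union> f ` {..<d})) = var_ideal"

definition zero_one_linear_sop ::
  "('v::finite, 'k::field) mpoly set \<Rightarrow> nat \<Rightarrow> (nat \<Rightarrow> ('v, 'k) mpoly) \<Rightarrow> bool" where
  "zero_one_linear_sop I d f \<longleftrightarrow> linear_sop I d f \<and> (\<forall>i<d. zero_one_coeffs (f i))"

text \<open>The vertices $z_1, \dots, z_d$ are required to be pairwise distinct.\<close>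

definition star_sop ::
  "'v::finite set set \<Rightarrow> nat \<Rightarrow> (nat \<Rightarrow> 'v) \<Rightarrow> (nat \<Rightarrow> ('v, 'k::field) mpoly) \<Rightarrow> bool" where
  "star_sop E d z f \<longleftrightarrow>
     zero_one_linear_sop (edge_ideal E) d f \<and>
     inj_on z {..<d} \<and>
     (\<forall>i<d. \<exists>A. A \<subseteq> nbrs E (z i) \<and> f i = mvar (z i) + (\<Sum>v\<in>A. mvar v))"

text \<open>The type argument is the coefficient field $K$.\<close>

definition has_star_sop :: "'k::field itself \<Rightarrow> 'v::finite set set \<Rightarrow> bool" where
  "has_star_sop K E \<longleftrightarrow>
     (\<exists>d (z :: nat \<Rightarrow> 'v) (f :: nat \<Rightarrow> ('v, 'k) mpoly). star_sop E d z f)"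

end

theory Submission
  imports Defs
begin

text \<open>Let the cycle be $x_0, \dots, x_{2k}$. The forms $f_i = x_{2i} + x_{2i+1} + x_{2i+2}$ for $i < k$
  are the stars at $x_1, x_3, \dots, x_{2k-1}$. Since $x_{2i+1} f_i \equiv x_{2i+1}^2$ modulo the edge
  ideal, the odd variables lie in the radical of $(I(G), f)$, so modulo this radical
  $x_0 \equiv -x_2 \equiv x_4 \equiv \dots \equiv \pm x_{2k}$. The closing edge $x_{2k} x_0$ then puts $x_0^2$,
  hence every variable, into the radical.

  The dimension of $S/I(G)$ is the maximal size $k$ of an independent set. A chain of primes of that
  length consists of primes generated by variables. For the upper bound, the variables outside a
  prime containing $I(G)$ form an independent set, and a chain of primes above it cannot be longer
  than their number, by the argument of Coquand and Lombardi: more elements than variables satisfy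
  an algebraic relation, and its lowest terms contradict the strictness of the chain.\<close>

section \<open>Ideals of type-class rings\<close>

text \<open>The carrier is the whole type and \<open>- a = - 1 * a\<close>, so closure under
  negation comes from absorption.\<close>

lemma ideal_type_iff:
  "ideal J (ring_of_type_algebra :: 'a::comm_ring_1 ring) \<longleftrightarrow>
     0 \<in> J \<and> (\<forall>a\<in>J. \<forall>b\<in>J. a + b \<in> J) \<and> (\<forall>a\<in>J. \<forall>r. r * a \<in> J)"
proof
  assume "ideal J (ring_of_type_algebra :: 'a ring)"
  then interpret ideal J "ring_of_type_algebra :: 'a ring" .
  show "0 \<in> J \<and> (\<forall>a\<in>J. \<forall>b\<in>J. a + b \<in> J) \<and> (\<forall>a\<in>J. \<forall>r. r * a \<in> J)"
    using additive_subgroup.zero_closed[OF is_additive_subgroup]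
      additive_subgroup.a_closed[OF is_additive_subgroup] I_l_closed
    by (simp add: ring_of_type_algebra_def)
next
  assume J: "0 \<in> J \<and> (\<forall>a\<in>J. \<forall>b\<in>J. a + b \<in> J) \<and> (\<forall>a\<in>J. \<forall>r. r * a \<in> J)"
  interpret cring "ring_of_type_algebra :: 'a ring"
    by (rule cring_from_type_algebra)
  have minus: "\<ominus>\<^bsub>ring_of_type_algebra\<^esub> a = - a" for a :: 'a
    by (rule minus_equality) (simp_all add: ring_of_type_algebra_def)
  show "ideal J (ring_of_type_algebra :: 'a ring)"
  proof (rule idealI[OF ring_axioms])
    show "subgroup J (add_monoid (ring_of_type_algebra :: 'a ring))"
    proof (rule add.subgroupI)
      fix a assume "a \<in> J"
      then have "- 1 * a \<in> J" using J by blast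
      then show "\<ominus>\<^bsub>ring_of_type_algebra\<^esub> a \<in> J" by (simp add: minus)
    qed (use J in \<open>auto simp: ring_of_type_algebra_def\<close>)
  qed (use J in \<open>auto simp: ring_of_type_algebra_def mult.commute\<close>)
qed

lemma ideal_typeD:
  assumes "ideal J (ring_of_type_algebra :: 'a::comm_ring_1 ring)"
  shows ideal_type_zero: "0 \<in> J"
    and ideal_type_add: "a \<in> J \<Longrightarrow> b \<in> J \<Longrightarrow> a + b \<in> J"
    and ideal_type_mult: "a \<in> J \<Longrightarrow> r * a \<in> J"
    and ideal_type_mult': "a \<in> J \<Longrightarrow> a * r \<in> J"
    and ideal_type_diff: "a \<in> J \<Longrightarrow> b \<in> J \<Longrightarrow> a - b \<in> J"
proof -
  note J = assms[unfolded ideal_type_iff]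
  show "0 \<in> J" "a \<in> J \<Longrightarrow> b \<in> J \<Longrightarrow> a + b \<in> J" and m: "\<And>a r. a \<in> J \<Longrightarrow> r * a \<in> J"
    using J by auto
  show "a \<in> J \<Longrightarrow> a * r \<in> J"
    using m[of a r] by (simp add: mult.commute)
  show "a \<in> J \<Longrightarrow> b \<in> J \<Longrightarrow> a - b \<in> J"
    using J m[of b "- 1"] by (metis add_uminus_conv_diff mult_minus1)
qed

lemma ideal_type_sum:
  assumes "ideal J (ring_of_type_algebra :: 'a::comm_ring_1 ring)" and "\<And>i. i \<in> A \<Longrightarrow> f i \<in> J"
  shows "sum f A \<in> J"
  using assms(2) by (induction A rule: infinite_finite_induct)
    (auto intro: ideal_type_zero[OF assms(1)] ideal_type_add[OF assms(1)])

lemma primeideal_type_iff: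
  "primeideal J (ring_of_type_algebra :: 'a::comm_ring_1 ring) \<longleftrightarrow>
     ideal J ring_of_type_algebra \<and> 1 \<notin> J \<and> (\<forall>a b. a * b \<in> J \<longrightarrow> a \<in> J \<or> b \<in> J)"
proof
  assume "primeideal J (ring_of_type_algebra :: 'a ring)"
  then interpret primeideal J "ring_of_type_algebra :: 'a ring" .
  show "ideal J ring_of_type_algebra \<and> 1 \<notin> J \<and> (\<forall>a b. a * b \<in> J \<longrightarrow> a \<in> J \<or> b \<in> J)"
    using I_notcarr I_prime one_imp_carrier is_ideal by (auto simp: ring_of_type_algebra_def)
next
  assume "ideal J ring_of_type_algebra \<and> 1 \<notin> J \<and> (\<forall>a b. a * b \<in> J \<longrightarrow> a \<in> J \<or> b \<in> J)"
  then show "primeideal J (ring_of_type_algebra :: 'a ring)"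
    by (intro primeidealI cring_from_type_algebra) (auto simp: ring_of_type_algebra_def)
qed

lemma primeideal_type_power:
  assumes "primeideal J (ring_of_type_algebra :: 'a::comm_ring_1 ring)" and "a ^ n \<in> J"
  shows "a \<in> J"
  using assms(2) by (induction n) (use assms(1) in \<open>auto simp: primeideal_type_iff\<close>)

lemma genideal_type:
  fixes A :: "'a::comm_ring_1 set"
  shows genideal_type_ideal: "ideal (Idl\<^bsub>ring_of_type_algebra\<^esub> A) ring_of_type_algebra"
    and genideal_type_self: "A \<subseteq> Idl\<^bsub>ring_of_type_algebra\<^esub> A"
    and genideal_type_minimal:
      "ideal J ring_of_type_algebra \<Longrightarrow> A \<subseteq> J \<Longrightarrow> Idl\<^bsub>ring_of_type_algebra\<^esub> A \<subseteq> J"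
proof -
  interpret cring "ring_of_type_algebra :: 'a ring"
    by (rule cring_from_type_algebra)
  have A: "A \<subseteq> carrier ring_of_type_algebra"
    by (simp add: ring_of_type_algebra_def)
  show "ideal (Idl\<^bsub>ring_of_type_algebra\<^esub> A) ring_of_type_algebra"
    "A \<subseteq> Idl\<^bsub>ring_of_type_algebra\<^esub> A"
    "ideal J ring_of_type_algebra \<Longrightarrow> A \<subseteq> J \<Longrightarrow> Idl\<^bsub>ring_of_type_algebra\<^esub> A \<subseteq> J"
    using genideal_ideal[OF A] genideal_self[OF A] genideal_minimal by auto
qed

lemma ideal_radical_type:
  "ideal_radical ring_of_type_algebra J = {a :: 'a::comm_ring_1. \<exists>k\<ge>1. a ^ k \<in> J}"
proof -
  have "a [^]\<^bsub>ring_of_type_algebra\<^esub> k = a ^ k" for a :: 'a and k :: nat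
    by (induction k) (simp_all add: nat_pow_def ring_of_type_algebra_def mult.commute)
  then show ?thesis
    by (simp add: ideal_radical_def ring_of_type_algebra_def)
qed

text \<open>Each term in the expansion of \<open>(a + b) ^ (m + n)\<close> contains \<open>a\<close>
  to at least the power \<open>m\<close> or \<open>b\<close> to at least the power
  \<open>n\<close>.\<close>

lemma ideal_ideal_radical_type:
  assumes J: "ideal J (ring_of_type_algebra :: 'a::comm_ring_1 ring)"
  shows "ideal (ideal_radical ring_of_type_algebra J) (ring_of_type_algebra :: 'a ring)"
  unfolding ideal_type_iff ideal_radical_type
proof (intro conjI ballI allI)
  show "0 \<in> {a. \<exists>k\<ge>1. a ^ k \<in> J}"
    using ideal_type_zero[OF J] by (auto intro!: exI[of _ 1])
next
  fix a r assume "a \<in> {a. \<exists>k\<ge>1. a ^ k \<in> J}"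
  then show "r * a \<in> {a. \<exists>k\<ge>1. a ^ k \<in> J}"
    by (auto simp: power_mult_distrib intro: ideal_type_mult[OF J])
next
  fix a b assume "a \<in> {a. \<exists>k\<ge>1. a ^ k \<in> J}" "b \<in> {a. \<exists>k\<ge>1. a ^ k \<in> J}"
  then obtain m n where mn: "m \<ge> 1" "a ^ m \<in> J" "n \<ge> 1" "b ^ n \<in> J" by blast
  have "of_nat (m + n choose i) * a ^ i * b ^ (m + n - i) \<in> J" if "i \<le> m + n" for i
  proof (cases "m \<le> i")
    case True
    then have "a ^ i = a ^ (i - m) * a ^ m" by (simp flip: power_add)
    then have "a ^ i \<in> J" using mn ideal_type_mult[OF J] by metis
    then show ?thesis by (intro ideal_type_mult[OF J] ideal_type_mult'[OF J])
  next
    case False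
    then have "b ^ (m + n - i) = b ^ (m - i) * b ^ n" by (simp flip: power_add)
    then have "b ^ (m + n - i) \<in> J" using mn ideal_type_mult[OF J] by metis
    then show ?thesis by (intro ideal_type_mult[OF J])
  qed
  then have "(a + b) ^ (m + n) \<in> J"
    unfolding binomial_ring by (intro ideal_type_sum[OF J]) auto
  then show "a + b \<in> {a. \<exists>k\<ge>1. a ^ k \<in> J}"
    using mn by (auto intro!: exI[of _ "m + n"])
qed

section \<open>Chains of prime ideals\<close>

text \<open>Ideals of the quotient correspond to ideals above \<open>I\<close>. Primality and strict
  inclusion pass in both directions, so chains can be counted in \<open>R\<close> itself.\<close>

lemma (in cring) krull_dim_Quot:
  assumes I: "ideal I R"
  shows "krull_dim (R Quot I) = Sup {enat l | l. \<exists>P :: nat \<Rightarrow> 'a set.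
     (\<forall>i\<le>l. primeideal (P i) R \<and> I \<subseteq> P i) \<and> (\<forall>i<l. P i \<subset> P (Suc i))}"
proof -
  let ?S = "R Quot I"
  let ?h = "(+>) I"
  have corr: "bij_betw (\<lambda>J. ?h ` J) {J. ideal J R \<and> I \<subseteq> J} {J. ideal J ?S}"
    by (rule quot_ideal_correspondence[OF I])
  \<comment> \<open>The image determines \<open>J\<close>: if \<open>x\<close> and some
    \<open>y\<close> in \<open>J\<close> have the same coset, then \<open>x - y\<close> lies in
    \<open>I\<close>, hence in \<open>J\<close>.\<close>
  have vim: "?h x \<in> ?h ` J \<longleftrightarrow> x \<in> J" if "ideal J R" "I \<subseteq> J" "x \<in> carrier R" for J x
  proof
    assume "?h x \<in> ?h ` J"
    then obtain y where y: "y \<in> J" "?h x = ?h y" by blast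
    have yc: "y \<in> carrier R" using y that ideal.Icarr by metis
    have "x \<ominus> y \<in> J"
      using quotient_eq_iff_same_a_r_cos[OF I that(3) yc] y that by blast
    then have "(x \<ominus> y) \<oplus> y \<in> J"
      using y(1) that(1) additive_subgroup.a_closed ideal.axioms(1) by metis
    moreover have "(x \<ominus> y) \<oplus> y = x"
      using that(3) yc by algebra
    ultimately show "x \<in> J" by simp
  qed auto
  have carr: "carrier ?S = ?h ` carrier R"
    by (auto simp: FactRing_simps)
  have prime: "primeideal (?h ` J) ?S" if "primeideal J R" "I \<subseteq> J" for J
  proof -
    interpret J: primeideal J R by fact
    show ?thesis
    proof (rule primeidealI)
      show "ideal (?h ` J) ?S"
        by (rule ring_ideal_imp_quot_ideal[OF I J.is_ideal])
      show "cring ?S"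
        by (rule ideal.quotient_is_cring[OF I cring_axioms])
      show "carrier ?S \<noteq> ?h ` J"
      proof
        assume "carrier ?S = ?h ` J"
        then have "?h x \<in> ?h ` J" if "x \<in> carrier R" for x
          using carr that by blast
        then have "carrier R \<subseteq> J"
          using vim[OF J.is_ideal that(2)] by blast
        then show False using J.I_notcarr J.Icarr by blast
      qed
      fix a b assume "a \<in> carrier ?S" "b \<in> carrier ?S" and ab: "a \<otimes>\<^bsub>?S\<^esub> b \<in> ?h ` J"
      then obtain x y where xy: "x \<in> carrier R" "a = ?h x" "y \<in> carrier R" "b = ?h y"
        unfolding carr by blast
      have "a \<otimes>\<^bsub>?S\<^esub> b = ?h (x \<otimes> y)"
        using xy by (simp add: FactRing_def ideal.rcoset_mult_add[OF I])
      then have "x \<otimes> y \<in> J"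
        using ab vim[OF J.is_ideal that(2)] xy by simp
      then show "a \<in> ?h ` J \<or> b \<in> ?h ` J"
        using J.I_prime xy by blast
    qed
  qed
  have preim: "\<exists>Q. primeideal Q R \<and> I \<subseteq> Q \<and> J = ?h ` Q" if "primeideal J ?S" for J
  proof -
    have "J \<in> (\<lambda>J. ?h ` J) ` {J. ideal J R \<and> I \<subseteq> J}"
      using corr that primeideal.axioms(1) unfolding bij_betw_def by blast
    then obtain Q where Q: "ideal Q R" "I \<subseteq> Q" "J = ?h ` Q" by blast
    \<comment> \<open>\<open>Q\<close> is the preimage of \<open>J\<close> under the projection, and
      preimages of primes are prime.\<close>
    have "{r \<in> carrier R. ?h r \<in> J} = Q"
      using vim[OF Q(1,2)] Q ideal.Icarr[OF Q(1)] by blast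
    then show ?thesis
      using ring_hom_ring.primeideal_vimage[OF ideal.rcos_ring_hom_ring[OF I] cring_axioms that] Q
      by auto
  qed
  have strict: "?h ` J \<subset> ?h ` J' \<longleftrightarrow> J \<subset> J'"
    if "primeideal J R" "I \<subseteq> J" "primeideal J' R" "I \<subseteq> J'" for J J'
  proof -
    have "ideal J R" "ideal J' R" using that primeideal.axioms(1) by auto
    then have "?h ` J \<subseteq> ?h ` J' \<longleftrightarrow> J \<subseteq> J'" "?h ` J' \<subseteq> ?h ` J \<longleftrightarrow> J' \<subseteq> J"
      using that vim ideal.Icarr by (metis image_mono image_subset_iff subsetI)+
    then show ?thesis by (auto simp: psubset_eq)
  qed
  have "(\<exists>P. (\<forall>i\<le>l. primeideal (P i) ?S) \<and> (\<forall>i<l. P i \<subset> P (Suc i))) \<longleftrightarrow>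
    (\<exists>P. (\<forall>i\<le>l. primeideal (P i) R \<and> I \<subseteq> P i) \<and> (\<forall>i<l. P i \<subset> P (Suc i)))" for l :: nat
  proof (intro iffI; elim exE conjE)
    fix P assume P: "\<forall>i\<le>l. primeideal (P i) ?S" "\<forall>i<l. P i \<subset> P (Suc i)"
    then have "\<forall>i\<in>{..l}. \<exists>Q. primeideal Q R \<and> I \<subseteq> Q \<and> P i = ?h ` Q" using preim by blast
    then obtain Q where "\<forall>i\<in>{..l}. primeideal (Q i) R \<and> I \<subseteq> Q i \<and> P i = ?h ` Q i"
      unfolding bchoice_iff by blast
    then have Q: "primeideal (Q i) R \<and> I \<subseteq> Q i \<and> P i = ?h ` Q i" if "i \<le> l" for i
      using that by simp
    have "Q i \<subset> Q (Suc i)" if "i < l" for i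
    proof -
      have "?h ` Q i \<subset> ?h ` Q (Suc i)"
        using P(2)[rule_format, OF that] that Q[of i] Q[of "Suc i"] by simp
      then show ?thesis
        using strict[of "Q i" "Q (Suc i)"] that Q[of i] Q[of "Suc i"] by simp
    qed
    then show "\<exists>P. (\<forall>i\<le>l. primeideal (P i) R \<and> I \<subseteq> P i) \<and> (\<forall>i<l. P i \<subset> P (Suc i))"
      using Q by blast
  next
    fix P assume P: "\<forall>i\<le>l. primeideal (P i) R \<and> I \<subseteq> P i" "\<forall>i<l. P i \<subset> P (Suc i)"
    then show "\<exists>P. (\<forall>i\<le>l. primeideal (P i) ?S) \<and> (\<forall>i<l. P i \<subset> P (Suc i))"
      using prime strict by (intro exI[of _ "\<lambda>i. ?h ` P i"]) (simp add: Suc_le_eq)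
  qed
  then show ?thesis unfolding krull_dim_def by simp
qed

text \<open>Dividing by the lowest power of \<open>y j\<close> in the relation, which is allowed modulo the prime
  \<open>P j\<close>, and then discarding multiples of \<open>y j\<close>, which lie in \<open>P (Suc j)\<close>, leaves a relation
  in the remaining elements modulo the next prime. At the end one unit is left.\<close>

lemma prime_chain_no_relation:
  fixes P :: "nat \<Rightarrow> 'a::comm_ring_1 set" and F :: "(nat \<Rightarrow> nat) set"
  assumes prime: "\<And>i. i \<le> m \<Longrightarrow> primeideal (P i) ring_of_type_algebra"
    and mono: "\<And>i. i < m \<Longrightarrow> P i \<subseteq> P (Suc i)"
    and y: "\<And>i. i < m \<Longrightarrow> y i \<in> P (Suc i) - P i"
    and F: "finite F" "F \<noteq> {}" "F \<subseteq> extensional {..<m}"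
    and unit: "\<And>e. e \<in> F \<Longrightarrow> u e dvd 1"
  shows "(\<Sum>e\<in>F. u e * (\<Prod>i<m. y i ^ e i)) \<notin> P 0"
proof
  assume rel: "(\<Sum>e\<in>F. u e * (\<Prod>i<m. y i ^ e i)) \<in> P 0"
  \<comment> \<open>Invariant: the surviving exponent vectors agree below \<open>j\<close>, and only
    the elements from \<open>y j\<close> on remain in the relation, now modulo
    \<open>P j\<close>.\<close>
  have "\<exists>F'\<subseteq>F. F' \<noteq> {} \<and> (\<forall>e\<in>F'. \<forall>e'\<in>F'. \<forall>i<j. e i = e' i) \<and>
      (\<Sum>e\<in>F'. u e * (\<Prod>i=j..<m. y i ^ e i)) \<in> P j" if "j \<le> m" for j
    using that
  proof (induction j)
    case 0
    then show ?case using F rel by (intro exI[of _ F]) (simp add: atLeast0LessThan)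
  next
    case (Suc j)
    then have j: "j < m" by simp
    from Suc.IH[OF less_imp_le[OF j]] obtain F' where F': "F' \<subseteq> F" "F' \<noteq> {}"
        "\<forall>e\<in>F'. \<forall>e'\<in>F'. \<forall>i<j. e i = e' i"
      and sum: "(\<Sum>e\<in>F'. u e * (\<Prod>i=j..<m. y i ^ e i)) \<in> P j" by blast
    have fin: "finite F'" using F' F finite_subset by blast
    define a where "a = Min ((\<lambda>e. e j) ` F')"
    have a_le: "a \<le> e j" if "e \<in> F'" for e
      using fin that by (simp add: a_def)
    have "a \<in> (\<lambda>e. e j) ` F'"
      unfolding a_def using fin F' by (intro Min_in) auto
    then obtain e0 where e0: "e0 \<in> F'" "e0 j = a" by auto
    define F'' where "F'' = {e \<in> F'. e j = a}"
    let ?r = "\<lambda>e. \<Prod>i=Suc j..<m. y i ^ e i"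
    have ids: "ideal (P j) ring_of_type_algebra" "ideal (P (Suc j)) ring_of_type_algebra"
      using prime[of j] prime[of "Suc j"] j by (auto simp: primeideal_type_iff)
    have "u e * (\<Prod>i=j..<m. y i ^ e i) = y j ^ a * (u e * y j ^ (e j - a) * ?r e)" if "e \<in> F'" for e
    proof -
      have "y j ^ e j = y j ^ a * y j ^ (e j - a)"
        using a_le[OF that] by (simp flip: power_add)
      then show ?thesis
        using j by (simp add: prod.atLeast_Suc_lessThan mult_ac)
    qed
    then have "y j ^ a * (\<Sum>e\<in>F'. u e * y j ^ (e j - a) * ?r e) \<in> P j"
      using sum by (simp add: sum_distrib_left)
    moreover have "y j ^ a \<notin> P j"
      using primeideal_type_power[OF prime, of j] y[OF j] j by auto
    ultimately have "(\<Sum>e\<in>F'. u e * y j ^ (e j - a) * ?r e) \<in> P j"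
      using prime[of j] j by (auto simp: primeideal_type_iff)
    then have all: "(\<Sum>e\<in>F'. u e * y j ^ (e j - a) * ?r e) \<in> P (Suc j)"
      using mono[OF j] by blast
    \<comment> \<open>Terms whose exponent exceeds the minimum \<open>a\<close> keep a factor
      \<open>y j\<close>, which lies in \<open>P (Suc j)\<close>.\<close>
    have "u e * y j ^ (e j - a) * ?r e \<in> P (Suc j)" if "e \<in> F' - F''" for e
    proof -
      have "e j - a = Suc (e j - a - 1)"
        using a_le[of e] that by (auto simp: F''_def)
      then have "y j ^ (e j - a) = y j * y j ^ (e j - a - 1)"
        by (metis power_Suc)
      then have "y j ^ (e j - a) \<in> P (Suc j)"
        using y[OF j] ideal_type_mult'[OF ids(2)] by auto
      then show ?thesis
        by (intro ideal_type_mult[OF ids(2)] ideal_type_mult'[OF ids(2)])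
    qed
    then have rest: "(\<Sum>e\<in>F'-F''. u e * y j ^ (e j - a) * ?r e) \<in> P (Suc j)"
      by (intro ideal_type_sum[OF ids(2)])
    have "(\<Sum>e\<in>F''. u e * y j ^ (e j - a) * ?r e) =
        (\<Sum>e\<in>F'. u e * y j ^ (e j - a) * ?r e) - (\<Sum>e\<in>F'-F''. u e * y j ^ (e j - a) * ?r e)"
      using fin by (subst sum_diff) (auto simp: F''_def)
    also have "\<dots> \<in> P (Suc j)"
      by (rule ideal_type_diff[OF ids(2) all rest])
    finally have "(\<Sum>e\<in>F''. u e * ?r e) \<in> P (Suc j)"
      by (simp add: F''_def)
    moreover have "F'' \<subseteq> F" "F'' \<noteq> {}" using F' e0 by (auto simp: F''_def)
    moreover have "\<forall>e\<in>F''. \<forall>e'\<in>F''. \<forall>i<Suc j. e i = e' i"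
      using F'(3) by (auto simp: F''_def less_Suc_eq)
    ultimately show ?case by blast
  qed
  from this[OF order_refl] obtain F' where F': "F' \<subseteq> F" "F' \<noteq> {}"
      "\<forall>e\<in>F'. \<forall>e'\<in>F'. \<forall>i<m. e i = e' i"
    and "(\<Sum>e\<in>F'. u e * (\<Prod>i=m..<m. y i ^ e i)) \<in> P m"
    by blast
  then have sum: "(\<Sum>e\<in>F'. u e) \<in> P m" by simp
  obtain e where e: "e \<in> F'" using F' by blast
  \<comment> \<open>Extensionality fixes the values outside \<open>{..<m}\<close>, so vectors that
    agree below \<open>m\<close> coincide.\<close>
  have "e' = e" if "e' \<in> F'" for e'
    by (rule extensionalityI[of _ "{..<m}"]) (use F F' that e in auto)
  then have "F' = {e}" using e by blast
  then have "u e \<in> P m" using sum by simp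
  moreover obtain w where "1 = u e * w" using unit[of e] e F' by blast
  ultimately show False
    using prime[of m] ideal_type_mult'[of "P m" "u e" w] by (auto simp: primeideal_type_iff)
qed

section \<open>Prime ideals of polynomial rings\<close>

text \<open>Indexing by \<open>A\<close> allows repeated vectors: equal values at two indices give
  the coefficients \<open>1\<close> and \<open>- 1\<close>, while an injective \<open>q\<close>
  yields too many vectors in \<open>span T\<close> to be independent.\<close>

lemma (in vector_space) linear_relation_if_card_less:
  assumes "finite A" "finite T" "q ` A \<subseteq> span T" "card T < card A"
  shows "\<exists>c. (\<exists>a\<in>A. c a \<noteq> 0) \<and> (\<Sum>a\<in>A. c a *s q a) = 0"
proof (cases "inj_on q A")
  case True
  have "dependent (q ` A)"
    using independent_span_bound[OF assms(2) _ assms(3)] assms(4) card_image[OF True] by auto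
  then obtain u where u: "\<exists>v\<in>q ` A. u v \<noteq> 0" "(\<Sum>v\<in>q ` A. u v *s v) = 0"
    using dependent_finite[of "q ` A"] assms(1) by auto
  then show ?thesis
    by (intro exI[of _ "u \<circ> q"]) (auto simp: sum.reindex[OF True])
next
  case False
  then obtain a b where ab: "a \<in> A" "b \<in> A" "a \<noteq> b" "q a = q b"
    by (auto simp: inj_on_def)
  let ?c = "\<lambda>x. if x = a then 1 else if x = b then - 1 else 0"
  have "(\<Sum>x\<in>A. ?c x *s q x) = (\<Sum>x\<in>{a, b}. ?c x *s q x)"
    using assms(1) ab by (intro sum.mono_neutral_right) auto
  also have "\<dots> = 0" using ab by simp
  finally show ?thesis using ab(1) by (intro exI[of _ ?c]) auto
qed

lemma vector_space_poly:
  "vector_space (\<lambda>(c :: 'k::field) p :: ('v, 'k) mpoly. Poly_Mapping.single 0 c * p)"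
  by unfold_locales (simp_all add: algebra_simps single_add mult_single)

lemma poly_eq_sum_single:
  fixes p :: "'a \<Rightarrow>\<^sub>0 'b::comm_monoid_add"
  shows "p = (\<Sum>m\<in>Poly_Mapping.keys p. Poly_Mapping.single m (Poly_Mapping.lookup p m))"
  by (rule poly_mapping_eqI) (auto simp: lookup_sum lookup_single when_def in_keys_iff)

lemma keys_multE:
  assumes "m \<in> Poly_Mapping.keys (p * q)"
  obtains a b where "a \<in> Poly_Mapping.keys p" "b \<in> Poly_Mapping.keys q" "m = a + b"
  using assms keys_mult[of p q] by blast

text \<open>Puts every term in which \<open>v\<close> occurs into each ideal containing
  \<open>mvar v\<close>. The subtraction of natural numbers is exact because the exponent is
  nonzero.\<close>

lemma single_eq_mult_mvar:
  assumes "Poly_Mapping.lookup m v \<noteq> 0"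
  shows "Poly_Mapping.single m (c :: 'k::field) =
    Poly_Mapping.single (m - Poly_Mapping.single v 1) c * mvar v"
proof -
  have "m - Poly_Mapping.single v 1 + Poly_Mapping.single v 1 = m"
    using assms by (intro poly_mapping_eqI) (auto simp: lookup_add lookup_minus lookup_single when_def)
  then show ?thesis by (simp add: mvar_def mult_single)
qed

text \<open>Split off the terms at \<open>a\<close> and \<open>b\<close>. By uniqueness, products
  involving any remaining term miss the monomial \<open>a + b\<close>, which leaves a single product
  of coefficients.\<close>

lemma lookup_mult_unique:
  fixes f g :: "'a::comm_monoid_add \<Rightarrow>\<^sub>0 'b::comm_ring_1"
  assumes "\<And>a' b'. a' \<in> Poly_Mapping.keys f \<Longrightarrow> b' \<in> Poly_Mapping.keys g \<Longrightarrow> a' + b' = a + b \<Longrightarrow> a' = a \<and> b' = b"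
  shows "Poly_Mapping.lookup (f * g) (a + b) = Poly_Mapping.lookup f a * Poly_Mapping.lookup g b"
proof -
  define f' where "f' = f - Poly_Mapping.single a (Poly_Mapping.lookup f a)"
  define g' where "g' = g - Poly_Mapping.single b (Poly_Mapping.lookup g b)"
  have f': "Poly_Mapping.keys f' \<subseteq> Poly_Mapping.keys f - {a}" and g': "Poly_Mapping.keys g' \<subseteq> Poly_Mapping.keys g - {b}"
    by (auto simp: f'_def g'_def in_keys_iff lookup_minus lookup_single when_def split: if_splits)
  have "f * g = f' * g + Poly_Mapping.single a (Poly_Mapping.lookup f a) * g'
      + Poly_Mapping.single (a + b) (Poly_Mapping.lookup f a * Poly_Mapping.lookup g b)"
    by (simp add: f'_def g'_def algebra_simps mult_single)
  moreover have "a + b \<notin> Poly_Mapping.keys (f' * g)"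
    using keys_mult[of f' g] f' assms by fastforce
  moreover have "a + b \<notin> Poly_Mapping.keys (Poly_Mapping.single a (Poly_Mapping.lookup f a) * g')"
  proof
    assume "a + b \<in> Poly_Mapping.keys (Poly_Mapping.single a (Poly_Mapping.lookup f a) * g')"
    then obtain b' where "Poly_Mapping.lookup f a \<noteq> 0" "b' \<in> Poly_Mapping.keys g'" "a + b' = a + b"
      using keys_mult[of "Poly_Mapping.single a (Poly_Mapping.lookup f a)" g'] by (fastforce split: if_splits)
    then show False using assms[of a b'] g' by (auto simp: in_keys_iff)
  qed
  ultimately show ?thesis
    by (simp add: lookup_add in_keys_iff)
qed

text \<open>The type of variables carries no order. Pulling back the lexicographic order on
  \<^typ>\<open>nat \<Rightarrow>\<^sub>0 nat\<close> gives an additive linear order on monomials, hence leading terms.\<close>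

lemma monomial_embedding:
  obtains \<phi> :: "('v::finite \<Rightarrow>\<^sub>0 nat) \<Rightarrow> (nat \<Rightarrow>\<^sub>0 nat)"
  where "\<And>m m'. \<phi> (m + m') = \<phi> m + \<phi> m'" "inj \<phi>"
proof -
  obtain h :: "'v \<Rightarrow> nat" where h: "inj h"
    using finite_imp_inj_to_nat_seg[of "UNIV :: 'v set"] by auto
  define \<phi> where "\<phi> m = (\<Sum>v\<in>UNIV. Poly_Mapping.single (h v) (Poly_Mapping.lookup m v))" for m :: "'v \<Rightarrow>\<^sub>0 nat"
  have "Poly_Mapping.lookup (\<phi> m) (h v) = Poly_Mapping.lookup m v" for m v
  proof -
    have "Poly_Mapping.lookup (\<phi> m) (h v) = (\<Sum>w\<in>UNIV. if w = v then Poly_Mapping.lookup m v else 0)"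
      using h by (auto simp: \<phi>_def lookup_sum lookup_single when_def inj_eq intro!: sum.cong)
    then show ?thesis by simp
  qed
  then have "inj \<phi>"
    by (intro injI poly_mapping_eqI) metis
  moreover have "\<phi> (m + m') = \<phi> m + \<phi> m'" for m m'
    by (simp add: \<phi>_def lookup_add single_add sum.distrib)
  ultimately show thesis using that by blast
qed

text \<open>The ideal generated by the variables in \<open>B\<close>, described by its monomials so
  that membership can be read off the support.\<close>

definition var_prime :: "'v set \<Rightarrow> ('v, 'k::field) mpoly set" where
  "var_prime B = {f. \<forall>m\<in>Poly_Mapping.keys f. \<exists>v\<in>B. Poly_Mapping.lookup m v \<noteq> 0}"

lemma mvar_in_var_prime: "mvar v \<in> (var_prime B :: ('v, 'k::field) mpoly set) \<longleftrightarrow> v \<in> B"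
  by (auto simp: var_prime_def mvar_def lookup_single when_def)

text \<open>If \<open>f\<close> and \<open>g\<close> lie outside, consider their largest terms free
  of variables from \<open>B\<close>: the product of these terms is again free of them and cannot
  cancel.\<close>

lemma primeideal_var_prime:
  "primeideal (var_prime B :: ('v::finite, 'k::field) mpoly set) poly_ring"
  unfolding primeideal_type_iff ideal_type_iff
proof (intro conjI ballI allI impI)
  show "0 \<in> (var_prime B :: ('v, 'k) mpoly set)"
    by (simp add: var_prime_def)
  show "1 \<notin> (var_prime B :: ('v, 'k) mpoly set)"
    by (simp add: var_prime_def)
  fix f g :: "('v, 'k) mpoly"
  show "f + g \<in> var_prime B" if "f \<in> var_prime B" "g \<in> var_prime B"
    using that Poly_Mapping.keys_add[of f g] by (auto simp: var_prime_def)
  show "g * f \<in> var_prime B" if f: "f \<in> var_prime B"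
    unfolding var_prime_def
  proof (intro CollectI ballI)
    fix m assume "m \<in> Poly_Mapping.keys (g * f)"
    then obtain a b where "b \<in> Poly_Mapping.keys f" "m = a + b"
      by (rule keys_multE)
    moreover obtain v where "v \<in> B" "Poly_Mapping.lookup b v \<noteq> 0"
      using f \<open>b \<in> Poly_Mapping.keys f\<close> unfolding var_prime_def by blast
    ultimately show "\<exists>v\<in>B. Poly_Mapping.lookup m v \<noteq> 0"
      by (intro bexI[of _ v]) (simp_all add: lookup_add)
  qed
  show "f \<in> var_prime B \<or> g \<in> var_prime B" if fg: "f * g \<in> var_prime B"
  proof (rule ccontr)
    assume nin: "\<not> (f \<in> var_prime B \<or> g \<in> var_prime B)"
    obtain \<phi> :: "('v \<Rightarrow>\<^sub>0 nat) \<Rightarrow> (nat \<Rightarrow>\<^sub>0 nat)"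
      where add: "\<And>m m'. \<phi> (m + m') = \<phi> m + \<phi> m'" and inj: "inj \<phi>"
      using monomial_embedding by blast
    define lead where "lead p a \<longleftrightarrow> a \<in> Poly_Mapping.keys p \<and> (\<forall>v\<in>B. Poly_Mapping.lookup a v = 0) \<and>
        (\<forall>a'\<in>Poly_Mapping.keys p. (\<forall>v\<in>B. Poly_Mapping.lookup a' v = 0) \<longrightarrow> \<phi> a' \<le> \<phi> a)"
      for p :: "('v, 'k) mpoly" and a
    have ex: "\<exists>a. lead p a" if "p \<notin> var_prime B" for p
    proof -
      let ?M = "{m \<in> Poly_Mapping.keys p. \<forall>v\<in>B. Poly_Mapping.lookup m v = 0}"
      have "?M \<noteq> {}" "finite ?M" using that by (auto simp: var_prime_def)
      then have "Max (\<phi> ` ?M) \<in> \<phi> ` ?M" and ge: "\<forall>m\<in>?M. \<phi> m \<le> Max (\<phi> ` ?M)" by auto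
      then obtain a where "a \<in> ?M" "Max (\<phi> ` ?M) = \<phi> a" by blast
      with ge show ?thesis by (intro exI[of _ a]) (simp add: lead_def)
    qed
    obtain a where "lead f a" using ex[of f] nin by blast
    then have a: "a \<in> Poly_Mapping.keys f" "\<forall>v\<in>B. Poly_Mapping.lookup a v = 0"
      "\<And>a'. a' \<in> Poly_Mapping.keys f \<Longrightarrow> \<forall>v\<in>B. Poly_Mapping.lookup a' v = 0 \<Longrightarrow> \<phi> a' \<le> \<phi> a"
      by (simp_all add: lead_def)
    obtain b where "lead g b" using ex[of g] nin by blast
    then have b: "b \<in> Poly_Mapping.keys g" "\<forall>v\<in>B. Poly_Mapping.lookup b v = 0"
      "\<And>b'. b' \<in> Poly_Mapping.keys g \<Longrightarrow> \<forall>v\<in>B. Poly_Mapping.lookup b' v = 0 \<Longrightarrow> \<phi> b' \<le> \<phi> b"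
      by (simp_all add: lead_def)
    have "Poly_Mapping.lookup (f * g) (a + b) = Poly_Mapping.lookup f a * Poly_Mapping.lookup g b"
    proof (rule lookup_mult_unique)
      fix a' b' assume *: "a' \<in> Poly_Mapping.keys f" "b' \<in> Poly_Mapping.keys g" "a' + b' = a + b"
      \<comment> \<open>Exponents add without cancellation, so \<open>a'\<close> and
        \<open>b'\<close> are free of \<open>B\<close> as well and the maximality of
        \<open>a\<close> and \<open>b\<close> applies to them.\<close>
      have "Poly_Mapping.lookup a' v = 0 \<and> Poly_Mapping.lookup b' v = 0" if "v \<in> B" for v
        using arg_cong[OF *(3), of "\<lambda>m. Poly_Mapping.lookup m v"] a(2) b(2) that by (simp add: lookup_add)
      then have "\<phi> a' \<le> \<phi> a" "\<phi> b' \<le> \<phi> b" using a(3) b(3) * by auto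
      moreover have "\<phi> a' + \<phi> b' = \<phi> a + \<phi> b" using *(3) add by metis
      ultimately have "\<phi> a' = \<phi> a"
        by (metis add_less_le_mono less_irrefl order_le_less)
      then have "a' = a" using inj by (simp add: inj_eq)
      then show "a' = a \<and> b' = b" using *(3) by simp
    qed
    then have "a + b \<in> Poly_Mapping.keys (f * g)"
      using a(1) b(1) by (simp add: in_keys_iff)
    then show False using fg a(2) b(2) by (auto simp: var_prime_def lookup_add)
  qed
qed

text \<open>A polynomial without constant term is a sum of multiples of variables. This makes
  primality available for \<open>var_ideal\<close>.\<close>

lemma var_prime_UNIV: "(var_prime UNIV :: ('v::finite, 'k::field) mpoly set) = var_ideal"
proof
  show "(var_ideal :: ('v, 'k) mpoly set) \<subseteq> var_prime UNIV"
    unfolding var_ideal_def using primeideal_var_prime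
    by (intro genideal_type_minimal) (auto simp: mvar_in_var_prime primeideal_type_iff)
  show "(var_prime UNIV :: ('v, 'k) mpoly set) \<subseteq> var_ideal"
  proof
    fix f :: "('v, 'k) mpoly" assume f: "f \<in> var_prime UNIV"
    have id: "ideal (var_ideal :: ('v, 'k) mpoly set) poly_ring"
      unfolding var_ideal_def by (rule genideal_type_ideal)
    have "Poly_Mapping.single m (Poly_Mapping.lookup f m) \<in> var_ideal" if m: "m \<in> Poly_Mapping.keys f" for m
    proof -
      obtain v where "Poly_Mapping.lookup m v \<noteq> 0" using f m by (auto simp: var_prime_def)
      moreover have "mvar v \<in> (var_ideal :: ('v, 'k) mpoly set)"
        using genideal_type_self[of "range mvar :: ('v, 'k) mpoly set"] by (auto simp: var_ideal_def)
      ultimately show ?thesis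
        using ideal_type_mult[OF id] single_eq_mult_mvar by metis
    qed
    then show "f \<in> var_ideal"
      by (subst poly_eq_sum_single) (rule ideal_type_sum[OF id])
  qed
qed

text \<open>Whether a prime lies above the edge ideal depends only on its variables: they must form
  a vertex cover.\<close>

lemma edge_ideal_subset_prime_iff:
  assumes "primeideal P (poly_ring :: ('v, 'k::field) mpoly ring)"
  shows "edge_ideal E \<subseteq> P \<longleftrightarrow> (\<forall>u v. {u, v} \<in> E \<longrightarrow> mvar u \<in> P \<or> mvar v \<in> P)"
proof
  assume "edge_ideal E \<subseteq> P"
  then have "mvar u * mvar v \<in> P" if "{u, v} \<in> E" for u v
    using that genideal_type_self[of "{mvar u * mvar v | u v. {u, v} \<in> E}"]
    unfolding edge_ideal_def by blast
  then show "\<forall>u v. {u, v} \<in> E \<longrightarrow> mvar u \<in> P \<or> mvar v \<in> P"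
    using assms by (auto simp: primeideal_type_iff)
next
  have id: "ideal P poly_ring" using assms by (simp add: primeideal_type_iff)
  assume "\<forall>u v. {u, v} \<in> E \<longrightarrow> mvar u \<in> P \<or> mvar v \<in> P"
  then have "mvar u * mvar v \<in> P" if "{u, v} \<in> E" for u v
    using that ideal_type_mult[OF id] ideal_type_mult'[OF id] by blast
  then show "edge_ideal E \<subseteq> P"
    unfolding edge_ideal_def by (intro genideal_type_minimal id) auto
qed

text \<open>Exponents are bounded one by one, not by total degree, so that the monomials form a box
  that is easy to count.\<close>

definition exponents_le :: "nat \<Rightarrow> ('v, 'k::field) mpoly set" where
  "exponents_le d = {p. \<forall>m\<in>Poly_Mapping.keys p. \<forall>v. Poly_Mapping.lookup m v \<le> d}"

lemma exponents_le_one: "1 \<in> exponents_le d"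
  by (simp add: exponents_le_def)

lemma exponents_le_mono: "p \<in> exponents_le d \<Longrightarrow> d \<le> d' \<Longrightarrow> p \<in> exponents_le d'"
  unfolding exponents_le_def using le_trans by blast

lemma exponents_le_mult:
  assumes "p \<in> exponents_le d" "q \<in> exponents_le d'"
  shows "p * q \<in> exponents_le (d + d')"
  unfolding exponents_le_def
proof (intro CollectI ballI allI)
  fix m v assume "m \<in> Poly_Mapping.keys (p * q)"
  then obtain a b where "a \<in> Poly_Mapping.keys p" "b \<in> Poly_Mapping.keys q" "m = a + b"
    by (rule keys_multE)
  then show "Poly_Mapping.lookup m v \<le> d + d'"
    using assms by (simp add: exponents_le_def lookup_add add_mono)
qed

lemma exponents_le_power: "p \<in> exponents_le d \<Longrightarrow> p ^ n \<in> exponents_le (n * d)"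
  by (induction n) (auto simp: exponents_le_one intro: exponents_le_mult)

lemma exponents_le_prod:
  assumes "\<And>i. i \<in> A \<Longrightarrow> f i \<in> exponents_le (d i)"
  shows "prod f A \<in> exponents_le (sum d A)"
  using assms by (induction A rule: infinite_finite_induct)
    (auto simp: exponents_le_one intro: exponents_le_mult)

lemma exponents_le_exists:
  fixes p :: "('v::finite, 'k::field) mpoly"
  shows "\<exists>d. p \<in> exponents_le d"
proof -
  have "Poly_Mapping.lookup m v \<le> Max ((\<lambda>(m, v). Poly_Mapping.lookup m v) ` (Poly_Mapping.keys p \<times> UNIV))" if "m \<in> Poly_Mapping.keys p" for m v
    using that by (intro Max_ge) (auto intro!: image_eqI[of _ _ "(m, v)"])
  then show ?thesis by (auto simp: exponents_le_def)
qed

text \<open>Restricting exponent vectors to \<open>W\<close> embeds these monomials into the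
  functions from \<open>W\<close> to \<open>{..d}\<close>.\<close>

lemma card_monomials_le:
  fixes W :: "'v::finite set" and d :: nat
  defines "T \<equiv> {m :: 'v \<Rightarrow>\<^sub>0 nat. Poly_Mapping.keys m \<subseteq> W \<and> (\<forall>v. Poly_Mapping.lookup m v \<le> d)}"
  shows "finite T" "card T \<le> (d + 1) ^ card W"
proof -
  let ?r = "\<lambda>m. restrict (Poly_Mapping.lookup m) W"
  have inj: "inj_on ?r T"
  proof (rule inj_onI, rule poly_mapping_eqI)
    fix m m' v assume "m \<in> T" "m' \<in> T" and eq: "?r m = ?r m'"
    then have "v \<notin> W \<Longrightarrow> Poly_Mapping.lookup m v = 0 \<and> Poly_Mapping.lookup m' v = 0"
      by (auto simp: T_def in_keys_iff)
    then show "Poly_Mapping.lookup m v = Poly_Mapping.lookup m' v"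
      using fun_cong[OF eq, of v] by (cases "v \<in> W") auto
  qed
  have sub: "?r ` T \<subseteq> PiE W (\<lambda>_. {..d})" by (auto simp: T_def)
  have fin: "finite (PiE W (\<lambda>_. {..d}))" by (intro finite_PiE) auto
  show "finite T" using inj sub fin finite_imageD finite_subset by blast
  have "card T \<le> card (PiE W (\<lambda>_. {..d}))"
    using card_mono[OF fin sub] card_image[OF inj] by simp
  then show "card T \<le> (d + 1) ^ card W" by (simp add: card_PiE)
qed

section \<open>The dimension of an edge ring\<close>

text \<open>Were the chain longer than the number of variables outside \<open>P 0\<close>, counting monomials in these
  variables would give a linear relation modulo \<open>P 0\<close> among the monomials in elements
  \<open>y i \<in> P (Suc i) - P i\<close>.\<close>

lemma prime_chain_length_le:
  fixes P :: "nat \<Rightarrow> ('v::finite, 'k::field) mpoly set"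
  assumes prime: "\<And>i. i \<le> l \<Longrightarrow> primeideal (P i) poly_ring"
    and chain: "\<And>i. i < l \<Longrightarrow> P i \<subset> P (Suc i)"
  shows "l \<le> card {v. mvar v \<notin> P 0}"
proof (rule ccontr)
  define W where "W = {v. mvar v \<notin> P 0}"
  \<comment> \<open>One more element than there are variables outside \<open>P 0\<close>; the first
    \<open>m\<close> steps of the chain supply them.\<close>
  define m where "m = Suc (card W)"
  assume "\<not> l \<le> card {v. mvar v \<notin> P 0}"
  then have m: "m \<le> l" by (simp add: m_def W_def)
  have id: "ideal (P 0) poly_ring" using prime[of 0] by (simp add: primeideal_type_iff)
  have "P (Suc i) - P i \<noteq> {}" if "i < m" for i
    using chain[of i] that m by auto
  then have "\<forall>i. \<exists>y. i < m \<longrightarrow> y \<in> P (Suc i) - P i" by blast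
  then obtain y where y: "\<And>i. i < m \<Longrightarrow> y i \<in> P (Suc i) - P i" by metis
  have "\<forall>i. \<exists>d. y i \<in> exponents_le d" using exponents_le_exists by blast
  then obtain d where d: "\<And>i. y i \<in> exponents_le (d i)" by metis
  define D where "D = (\<Sum>i<m. d i)"
  \<comment> \<open>Since \<open>N > (D + 1) ^ card W\<close> and \<open>m\<close> exceeds
    \<open>card W\<close> by one, \<open>N ^ m\<close> is larger than
    \<open>(N * (D + 1)) ^ card W\<close>. Hence \<open>A\<close> has more elements than
    \<open>T\<close>.\<close>
  define N where "N = Suc ((D + 1) ^ card W)"
  define A where "A = PiE {..<m} (\<lambda>_. {..<N})"
  define T where "T = {u :: 'v \<Rightarrow>\<^sub>0 nat. Poly_Mapping.keys u \<subseteq> W \<and> (\<forall>v. Poly_Mapping.lookup u v \<le> N * D)}"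
  let ?y = "\<lambda>e. \<Prod>i<m. y i ^ e i"
  interpret vector_space "\<lambda>(c :: 'k) p :: ('v, 'k) mpoly. Poly_Mapping.single 0 c * p"
    by (rule vector_space_poly)
  have finA: "finite A" and cardA: "card A = N ^ m"
    by (auto simp: A_def card_PiE finite_PiE)
  have finT: "finite T" unfolding T_def by (rule card_monomials_le(1))
  have "card T \<le> (N * D + 1) ^ card W" unfolding T_def by (rule card_monomials_le(2))
  also have "\<dots> \<le> (N * (D + 1)) ^ card W"
    by (rule power_mono) (auto simp: N_def)
  also have "\<dots> < N ^ m"
  proof -
    have "N ^ card W * (D + 1) ^ card W < N ^ card W * N"
      by (intro mult_strict_left_mono zero_less_power) (simp_all add: N_def)
    then show ?thesis by (simp only: m_def power_mult_distrib power_Suc2)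
  qed
  finally have cardT: "card T < card A" by (simp add: cardA)
  let ?B = "(\<lambda>u. Poly_Mapping.single u 1) ` T :: ('v, 'k) mpoly set"
  \<comment> \<open>A term with a variable outside \<open>W\<close> lies in \<open>P 0\<close>, so
    modulo \<open>P 0\<close> only monomials in \<open>T\<close> survive.\<close>
  have reduce: "\<exists>q\<in>span ?B. p - q \<in> P 0" if p: "p \<in> exponents_le (N * D)" for p
  proof -
    define q where "q = (\<Sum>u\<in>Poly_Mapping.keys p \<inter> T. Poly_Mapping.single u (Poly_Mapping.lookup p u))"
    have "Poly_Mapping.single u c \<in> span ?B" if "u \<in> T" for u c
    proof -
      have "Poly_Mapping.single u c = Poly_Mapping.single 0 c * Poly_Mapping.single u 1"
        by (simp add: mult_single)
      then show ?thesis using that span_scale span_base by (metis image_eqI)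
    qed
    then have "q \<in> span ?B" unfolding q_def by (intro span_sum) auto
    moreover have "p - q \<in> P 0"
    proof -
      have "p - q = (\<Sum>u\<in>Poly_Mapping.keys p - T. Poly_Mapping.single u (Poly_Mapping.lookup p u))"
        by (subst poly_eq_sum_single[of p])
          (simp add: q_def sum.Int_Diff[of "Poly_Mapping.keys p" _ T])
      moreover have "Poly_Mapping.single u (Poly_Mapping.lookup p u) \<in> P 0"
        if u: "u \<in> Poly_Mapping.keys p - T" for u
      proof -
        obtain v where "v \<in> Poly_Mapping.keys u" "v \<notin> W"
          using u p by (auto simp: T_def exponents_le_def)
        then have "Poly_Mapping.lookup u v \<noteq> 0" "mvar v \<in> P 0"
          by (auto simp: W_def in_keys_iff)
        then show ?thesis using ideal_type_mult[OF id] single_eq_mult_mvar by metis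
      qed
      ultimately show ?thesis using ideal_type_sum[OF id] by metis
    qed
    ultimately show ?thesis by blast
  qed
  have y_exp: "?y e \<in> exponents_le (N * D)" if "e \<in> A" for e
  proof (rule exponents_le_mono)
    show "?y e \<in> exponents_le (\<Sum>i<m. e i * d i)"
      by (intro exponents_le_prod exponents_le_power d)
    have "e i * d i \<le> N * d i" if "i < m" for i
      using \<open>e \<in> A\<close> that by (intro mult_right_mono) (auto simp: A_def PiE_def Pi_def less_imp_le)
    then show "(\<Sum>i<m. e i * d i) \<le> N * D"
      by (auto simp: D_def sum_distrib_left intro: sum_mono)
  qed
  have "\<forall>e\<in>A. \<exists>q. q \<in> span ?B \<and> ?y e - q \<in> P 0" using reduce y_exp by blast
  then obtain q where "\<forall>e\<in>A. q e \<in> span ?B \<and> ?y e - q e \<in> P 0"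
    by (rule bchoice[THEN exE])
  then have q: "q e \<in> span ?B" "?y e - q e \<in> P 0" if "e \<in> A" for e
    using that by simp_all
  have q_span: "q ` A \<subseteq> span ?B" using q(1) by (rule image_subsetI)
  have card_B: "card ?B < card A" using card_image_le[OF finT] cardT le_less_trans by blast
  obtain c where c: "\<exists>e\<in>A. c e \<noteq> 0" "(\<Sum>e\<in>A. Poly_Mapping.single 0 (c e) * q e) = 0"
    using linear_relation_if_card_less[OF finA finite_imageI[OF finT] q_span card_B] by blast
  \<comment> \<open>Nonzero constants are units, as the exclusion of relations along the chain
    requires.\<close>
  let ?F = "{e \<in> A. c e \<noteq> 0}"
  have "(\<Sum>e\<in>?F. Poly_Mapping.single 0 (c e) * ?y e) = (\<Sum>e\<in>A. Poly_Mapping.single 0 (c e) * ?y e)"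
    using finA by (intro sum.mono_neutral_left) auto
  \<comment> \<open>The relation among the \<open>q e\<close> holds exactly, so subtracting it
    changes nothing and exposes summands in \<open>P 0\<close>.\<close>
  also have "\<dots> = (\<Sum>e\<in>A. Poly_Mapping.single 0 (c e) * (?y e - q e))"
    using c(2) by (simp add: right_diff_distrib sum_subtractf)
  also have "\<dots> \<in> P 0"
    by (intro ideal_type_sum[OF id] ideal_type_mult[OF id] q)
  finally have "(\<Sum>e\<in>?F. Poly_Mapping.single 0 (c e) * ?y e) \<in> P 0" .
  moreover have "(\<Sum>e\<in>?F. Poly_Mapping.single 0 (c e) * ?y e) \<notin> P 0"
  proof (rule prime_chain_no_relation)
    show "finite ?F" "?F \<noteq> {}" "?F \<subseteq> extensional {..<m}"
      using finA c(1) by auto (auto simp: A_def PiE_def)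
    show "Poly_Mapping.single 0 (c e) dvd (1 :: ('v, 'k) mpoly)" if "e \<in> ?F" for e
    proof (rule dvdI)
      show "1 = Poly_Mapping.single 0 (c e) * (Poly_Mapping.single 0 (inverse (c e)) :: ('v, 'k) mpoly)"
        using that by (simp add: mult_single)
    qed
    show "primeideal (P i) poly_ring" if "i \<le> m" for i
      using prime that m by simp
    show "P i \<subseteq> P (Suc i)" if "i < m" for i
      using chain[of i] that m by auto
    show "y i \<in> P (Suc i) - P i" if "i < m" for i
      using y that .
  qed
  ultimately show False by blast
qed

text \<open>The case \<open>u = v\<close> excludes singleton edges, which would put the square of a
  variable into the edge ideal. This fits the vertex cover criterion for arbitrary
  \<open>E\<close>.\<close>

definition independent_vertices :: "'v set set \<Rightarrow> 'v set \<Rightarrow> bool" where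
  "independent_vertices E W \<longleftrightarrow> (\<forall>u\<in>W. \<forall>v\<in>W. {u, v} \<notin> E)"

lemma krull_dim_edge_ideal:
  fixes E :: "'v::finite set set" and W :: "'v set"
  assumes W: "independent_vertices E W"
    and max: "\<And>W'. independent_vertices E W' \<Longrightarrow> card W' \<le> card W"
  shows "krull_dim ((poly_ring :: ('v, 'k::field) mpoly ring) Quot edge_ideal E) = enat (card W)"
proof -
  interpret cring "poly_ring :: ('v, 'k) mpoly ring"
    by (rule cring_from_type_algebra)
  have "ideal (edge_ideal E) (poly_ring :: ('v, 'k) mpoly ring)"
    unfolding edge_ideal_def by (rule genideal_type_ideal)
  then have "krull_dim ((poly_ring :: ('v, 'k) mpoly ring) Quot edge_ideal E) =
      Sup {enat l | l. \<exists>P :: nat \<Rightarrow> ('v, 'k) mpoly set.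
        (\<forall>i\<le>l. primeideal (P i) poly_ring \<and> edge_ideal E \<subseteq> P i) \<and> (\<forall>i<l. P i \<subset> P (Suc i))}"
    (is "_ = Sup ?L")
    by (rule krull_dim_Quot)
  also have "\<dots> = enat (card W)"
  proof (rule antisym)
    show "Sup ?L \<le> enat (card W)"
    proof (rule Sup_least)
      fix x assume "x \<in> ?L"
      then obtain l and P :: "nat \<Rightarrow> ('v, 'k) mpoly set" where x: "x = enat l"
        and P: "\<forall>i\<le>l. primeideal (P i) poly_ring \<and> edge_ideal E \<subseteq> P i" "\<forall>i<l. P i \<subset> P (Suc i)"
        by blast
      have "independent_vertices E {v. mvar v \<notin> P 0}"
        using P(1) edge_ideal_subset_prime_iff[of "P 0" E] by (auto simp: independent_vertices_def)
      then have "card {v. mvar v \<notin> P 0} \<le> card W" by (rule max)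
      moreover have "l \<le> card {v. mvar v \<notin> P 0}"
        using P by (intro prime_chain_length_le) auto
      ultimately show "x \<le> enat (card W)" by (simp add: x)
    qed
    obtain h where h: "bij_betw h {..<card W} W"
      using ex_bij_betw_nat_finite[of W] by (auto simp: atLeast0LessThan)
    \<comment> \<open>The complement of \<open>W\<close> is a vertex cover because \<open>W\<close>
      is independent. Adding the vertices of \<open>W\<close> one at a time gives
      \<open>card W\<close> strict inclusions.\<close>
    define B where "B j = - W \<union> h ` {..<j}" for j
    define P :: "nat \<Rightarrow> ('v, 'k) mpoly set" where "P j = var_prime (B j)" for j
    have prime: "primeideal (P j) poly_ring" for j
      unfolding P_def by (rule primeideal_var_prime)
    have "edge_ideal E \<subseteq> P j" for j
      unfolding edge_ideal_subset_prime_iff[OF prime]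
      using W by (auto simp: P_def mvar_in_var_prime B_def independent_vertices_def)
    moreover have "P j \<subset> P (Suc j)" if "j < card W" for j
    proof -
      have "P j \<subseteq> P (Suc j)" by (fastforce simp: P_def var_prime_def B_def)
      moreover have "h j \<in> W" "h j \<notin> h ` {..<j}"
        using h that inj_on_image_mem_iff[of h "{..<card W}" j "{..<j}"] by (auto simp: bij_betw_def)
      then have "mvar (h j) \<in> P (Suc j) - P j"
        by (simp add: P_def mvar_in_var_prime B_def)
      ultimately show ?thesis by blast
    qed
    ultimately show "enat (card W) \<le> Sup ?L"
      using prime by (intro Sup_upper) blast
  qed
  finally show ?thesis .
qed

section \<open>The star-system of an odd cycle\<close>

lemma linear_form_sum_mvar:
  fixes A :: "'v::finite set"
  shows "linear_form (\<Sum>v\<in>A. mvar v :: ('v, 'k::field) mpoly)"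
proof -
  have "(\<Sum>v\<in>A. mvar v) =
      (\<Sum>v\<in>UNIV. Poly_Mapping.single (Poly_Mapping.single v 1) (if v \<in> A then 1 else 0 :: 'k))"
    unfolding mvar_def by (intro sum.mono_neutral_cong_left) auto
  then show ?thesis
    unfolding linear_form_def by (intro exI[of _ "\<lambda>v. if v \<in> A then 1 else 0"])
qed

text \<open>Summing over a set lets each variable occur at most once, so no coefficient
  \<open>1 + 1\<close> arises.\<close>

lemma zero_one_coeffs_sum_mvar:
  fixes A :: "'v::finite set"
  shows "zero_one_coeffs (\<Sum>v\<in>A. mvar v :: ('v, 'k::field) mpoly)"
  unfolding zero_one_coeffs_def
proof
  fix m
  show "Poly_Mapping.lookup (\<Sum>v\<in>A. mvar v :: ('v, 'k) mpoly) m \<in> {0, 1}"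
  proof (cases "\<exists>w\<in>A. m = Poly_Mapping.single w 1")
    case True
    then obtain w where w: "w \<in> A" "m = Poly_Mapping.single w 1" by blast
    have eq: "Poly_Mapping.single v (1 :: nat) = Poly_Mapping.single w 1 \<longleftrightarrow> v = w" for v
      by (metis keys_single one_neq_zero singleton_inject)
    have "Poly_Mapping.lookup (\<Sum>v\<in>A. mvar v :: ('v, 'k) mpoly) m = (\<Sum>v\<in>A. if v = w then 1 else 0)"
      unfolding lookup_sum by (intro sum.cong) (simp_all only: w mvar_def lookup_single when_def eq)
    then show ?thesis using w by simp
  next
    case False
    then have "Poly_Mapping.lookup (\<Sum>v\<in>A. mvar v :: ('v, 'k) mpoly) m = 0"
      unfolding lookup_sum by (intro sum.neutral) (auto simp: mvar_def lookup_single when_def)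
    then show ?thesis by simp
  qed
qed

theorem proposition4p13:
  fixes E :: "'v::finite set set"
  assumes "cycle_graph E" and "odd CARD('v)"
  shows "has_star_sop TYPE('k::field) E"
proof -
  obtain k where n: "CARD('v) = 2 * k + 1" using assms(2) by (elim oddE)
  from assms(1) obtain c :: "nat \<Rightarrow> 'v" where k: "k \<ge> 1"
    and c: "bij_betw c {..<2 * k + 1} UNIV"
    and E: "E = {{c i, c (Suc i mod (2 * k + 1))} | i. i < 2 * k + 1}"
    unfolding cycle_graph_def n by auto
  have c_eq: "c i = c j \<longleftrightarrow> i = j" if "i \<le> 2 * k" "j \<le> 2 * k" for i j
    using c that by (auto simp: bij_betw_def inj_on_def less_Suc_eq_le)
  have c_ex: "\<exists>i\<le>2 * k. v = c i" for v
    using c by (force simp: bij_betw_def less_Suc_eq_le set_eq_iff image_iff)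
  have edge: "{c i, c (Suc i)} \<in> E" if "i < 2 * k" for i
    unfolding E using that by (intro CollectI exI[of _ i]) simp
  have edge_last: "{c 0, c (2 * k)} \<in> E"
    unfolding E by (intro CollectI exI[of _ "2 * k"]) (simp add: insert_commute)

  \<comment> \<open>Independent sets of the odd cycle\<close>
  have max: "card W \<le> k" if W: "independent_vertices E W" for W
  proof -
    \<comment> \<open>Shifting the indices of \<open>W\<close> by one around the cycle gives a
      disjoint set of the same size, so \<open>2 * card W \<le> 2 * k + 1\<close>.\<close>
    define J where "J = {i. i < 2 * k + 1 \<and> c i \<in> W}"
    let ?s = "\<lambda>i. Suc i mod (2 * k + 1)"
    have "inj_on ?s {..<2 * k + 1}"
      by (auto simp: inj_on_def mod_Suc split: if_splits)
    then have inj: "inj_on ?s J"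
      by (rule inj_on_subset) (auto simp: J_def)
    have "v \<in> c ` J" if "v \<in> W" for v
      using c_ex[of v] that by (auto simp: J_def less_Suc_eq_le)
    then have "c ` J = W"
      by (auto simp: J_def)
    moreover have "inj_on c J"
      by (auto simp: J_def inj_on_def c_eq less_Suc_eq_le)
    ultimately have "card J = card W" by (metis card_image)
    moreover have "J \<inter> ?s ` J = {}"
      using W unfolding J_def independent_vertices_def E by blast
    then have "card (J \<union> ?s ` J) = card J + card J"
      using inj by (subst card_Un_disjoint) (auto simp: J_def card_image)
    moreover have "J \<union> ?s ` J \<subseteq> {..<2 * k + 1}"
      by (auto simp: J_def)
    then have "card (J \<union> ?s ` J) \<le> 2 * k + 1"
      using card_mono[of "{..<2 * k + 1}"] by simp
    ultimately show ?thesis by simp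
  qed

  \<comment> \<open>Centres of the stars and the dimension\<close>
  define z where "z i = c (2 * i + 1)" for i
  have inj_z: "inj_on z {..<k}"
    by (auto simp: inj_on_def z_def c_eq)
  have "independent_vertices E (z ` {..<k})"
    unfolding independent_vertices_def
  proof (intro ballI notI)
    fix u v assume "u \<in> z ` {..<k}" "v \<in> z ` {..<k}" and uv: "{u, v} \<in> E"
    then obtain a b where ab: "a < k" "b < k" "u = c (2 * a + 1)" "v = c (2 * b + 1)"
      by (auto simp: z_def)
    obtain i where i: "i < 2 * k + 1" "{u, v} = {c i, c (Suc i mod (2 * k + 1))}"
      using uv unfolding E by blast
    have s: "Suc i mod (2 * k + 1) \<le> 2 * k"
      by (simp flip: less_Suc_eq_le)
    have "i = 2 * a + 1 \<and> Suc i mod (2 * k + 1) = 2 * b + 1 \<or>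
        i = 2 * b + 1 \<and> Suc i mod (2 * k + 1) = 2 * a + 1"
      using i s ab by (auto simp: doubleton_eq_iff c_eq)
    \<comment> \<open>Consecutive indices differ in parity, except on the closing edge, whose ends
      \<open>2 * k\<close> and \<open>0\<close> are both even. No edge joins two odd
      indices.\<close>
    then have "odd i" "odd (Suc i mod (2 * k + 1))" by auto
    then show False using i(1) by (auto simp: mod_Suc split: if_splits)
  qed
  moreover have card_z: "card (z ` {..<k}) = k"
    using inj_z by (simp add: card_image)
  ultimately have dim: "krull_dim ((poly_ring :: ('v, 'k) mpoly ring) Quot edge_ideal E) = enat k"
    using krull_dim_edge_ideal[of E "z ` {..<k}"] max by simp

  \<comment> \<open>The linear forms\<close>
  define f :: "nat \<Rightarrow> ('v, 'k) mpoly"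
    where "f i = mvar (c (2 * i + 1)) + (mvar (c (2 * i)) + mvar (c (2 * i + 2)))" for i
  \<comment> \<open>For \<open>i < k\<close> the indices stay within \<open>2 * k\<close>, so the
    three vertices are distinct and each contributes one summand.\<close>
  have f_sum: "f i = (\<Sum>v\<in>{c (2 * i), c (2 * i + 1), c (2 * i + 2)}. mvar v)" if "i < k" for i
    using that by (simp add: f_def c_eq add_ac)
  have linear: "linear_form (f i)" and coeffs: "zero_one_coeffs (f i)" if "i < k" for i
    unfolding f_sum[OF that] by (rule linear_form_sum_mvar zero_one_coeffs_sum_mvar)+
  have star: "\<exists>A\<subseteq>nbrs E (z i). f i = mvar (z i) + (\<Sum>v\<in>A. mvar v)" if "i < k" for i
  proof (intro exI conjI)
    show "{c (2 * i), c (2 * i + 2)} \<subseteq> nbrs E (z i)"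
      using edge[of "2 * i"] edge[of "2 * i + 1"] that
      by (simp add: nbrs_def z_def insert_commute)
    show "f i = mvar (z i) + (\<Sum>v\<in>{c (2 * i), c (2 * i + 2)}. mvar v)"
      using that by (simp add: f_def z_def c_eq)
  qed

  \<comment> \<open>The radical of the edge ideal together with the forms\<close>
  let ?J = "Idl\<^bsub>poly_ring\<^esub> (edge_ideal E \<union> f ` {..<k})"
  let ?R = "ideal_radical poly_ring ?J"
  have J: "ideal ?J poly_ring" by (rule genideal_type_ideal)
  have R: "ideal ?R poly_ring" by (rule ideal_ideal_radical_type[OF J])
  have in_J: "edge_ideal E \<subseteq> ?J" "f ` {..<k} \<subseteq> ?J"
    using genideal_type_self[of "edge_ideal E \<union> f ` {..<k}"] by auto
  have J_R: "?J \<subseteq> ?R"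
    unfolding ideal_radical_type by (auto intro!: exI[of _ 1])
  have sq_R: "a \<in> ?R" if "a * a \<in> ?J" for a
    using that unfolding ideal_radical_type by (auto intro!: exI[of _ 2] simp: power2_eq_square)
  have edge_J: "mvar u * mvar v \<in> ?J" if "{u, v} \<in> E" for u v
    using that in_J(1) genideal_type_self[of "{mvar u * mvar v | u v. {u, v} \<in> E}"]
    unfolding edge_ideal_def by blast
  \<comment> \<open>Multiplying the star at \<open>z\<close> by \<open>z\<close> kills its other terms, so \<open>z\<^sup>2\<close> lies in the ideal. Modulo
    the radical the stars then become \<open>x\<^bsub>2i\<^esub> + x\<^bsub>2i+2\<^esub>\<close>.\<close>
  have odd_R: "mvar (c (2 * i + 1)) \<in> ?R" if "i < k" for i
  proof (rule sq_R)
    let ?x = "\<lambda>j. mvar (c j) :: ('v, 'k) mpoly"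
    have "?x (2 * i + 1) * ?x (2 * i + 1) =
        ?x (2 * i + 1) * f i - ?x (2 * i) * ?x (2 * i + 1) - ?x (2 * i + 1) * ?x (2 * i + 2)"
      by (simp add: f_def algebra_simps)
    also have "\<dots> \<in> ?J"
    proof (intro ideal_type_diff[OF J])
      show "?x (2 * i + 1) * f i \<in> ?J" using in_J(2) that by (intro ideal_type_mult[OF J]) blast
      show "?x (2 * i) * ?x (2 * i + 1) \<in> ?J" "?x (2 * i + 1) * ?x (2 * i + 2) \<in> ?J"
        using edge[of "2 * i"] edge[of "2 * i + 1"] that by (auto intro!: edge_J)
    qed
    finally show "?x (2 * i + 1) * ?x (2 * i + 1) \<in> ?J" .
  qed
  have even_R: "mvar (c 0) - (- 1) ^ i * mvar (c (2 * i)) \<in> ?R" if "i \<le> k" for i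
    using that
  proof (induction i)
    case 0
    then show ?case using ideal_type_zero[OF R] by simp
  next
    case (Suc i)
    have "f i \<in> ?R"
      by (rule subsetD[OF J_R], rule subsetD[OF in_J(2)]) (use Suc.prems in auto)
    \<comment> \<open>The added term is \<open>(- 1) ^ i\<close> times the sum of the variables at
      \<open>2 * i\<close> and \<open>2 * i + 2\<close>: the old one cancels and the new one appears
      with the opposite sign.\<close>
    then have "(mvar (c 0) - (- 1) ^ i * mvar (c (2 * i))) + (- 1) ^ i * (f i - mvar (c (2 * i + 1))) \<in> ?R"
      using Suc odd_R[of i]
      by (intro ideal_type_add[OF R Suc.IH ideal_type_mult[OF R ideal_type_diff[OF R]]]) auto
    then show ?case by (simp add: f_def algebra_simps)
  qed
  have first_R: "mvar (c 0) \<in> ?R"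
  proof -
    let ?a = "mvar (c 0) :: ('v, 'k) mpoly" and ?b = "mvar (c (2 * k)) :: ('v, 'k) mpoly"
    have ab: "?a * ?b \<in> ?R" using edge_J[OF edge_last] J_R by blast
    \<comment> \<open>The two occurrences of \<open>?a * ?b\<close> cancel, leaving the square of
      \<open>?a\<close>.\<close>
    have "?a * (?a - (- 1) ^ k * ?b) + (- 1) ^ k * (?a * ?b) \<in> ?R"
      by (rule ideal_type_add[OF R ideal_type_mult[OF R even_R[OF order_refl]] ideal_type_mult[OF R ab]])
    then have "?a ^ 2 \<in> ?R" by (simp add: algebra_simps power2_eq_square)
    then obtain j where "j \<ge> 1" "(?a ^ 2) ^ j \<in> ?J" unfolding ideal_radical_type by blast
    then show ?thesis
      unfolding ideal_radical_type by (auto intro!: exI[of _ "2 * j"] simp: power_mult)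
  qed
  have even_R': "mvar (c (2 * i)) \<in> ?R" if "i \<le> k" for i
  proof -
    let ?a = "mvar (c 0) :: ('v, 'k) mpoly" and ?b = "mvar (c (2 * i)) :: ('v, 'k) mpoly"
    \<comment> \<open>The inner difference is \<open>(- 1) ^ i * ?b\<close>; the second sign cancels
      the first.\<close>
    have "(- 1) ^ i * (?a - (?a - (- 1) ^ i * ?b)) \<in> ?R"
      by (rule ideal_type_mult[OF R ideal_type_diff[OF R first_R even_R[OF that]]])
    then show ?thesis by (simp flip: mult.assoc power_add)
  qed
  have "mvar v \<in> ?R" for v
  proof -
    obtain j where j: "j \<le> 2 * k" "v = c j" using c_ex by blast
    show ?thesis
    proof (cases "even j")
      case True
      then show ?thesis using j even_R' by (auto elim: evenE)
    next
      case False
      then show ?thesis using j odd_R by (auto elim!: oddE)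
    qed
  qed
  then have "var_ideal \<subseteq> ?R"
    unfolding var_ideal_def by (intro genideal_type_minimal[OF R]) auto
  \<comment> \<open>The ideal of all variables contains the edges and the forms; being prime, it
    also contains the radical of what they generate.\<close>
  moreover have "?R \<subseteq> var_ideal"
  proof -
    have prime: "primeideal (var_ideal :: ('v, 'k) mpoly set) poly_ring"
      unfolding var_prime_UNIV[symmetric] by (rule primeideal_var_prime)
    then have id: "ideal (var_ideal :: ('v, 'k) mpoly set) poly_ring"
      by (simp add: primeideal_type_iff)
    have var: "mvar v \<in> (var_ideal :: ('v, 'k) mpoly set)" for v
      by (simp flip: var_prime_UNIV add: mvar_in_var_prime)
    have "edge_ideal E \<subseteq> (var_ideal :: ('v, 'k) mpoly set)"
      by (simp add: edge_ideal_subset_prime_iff[OF prime] var)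
    moreover have "f ` {..<k} \<subseteq> var_ideal"
      by (auto simp: f_def intro!: ideal_type_add[OF id] var)
    ultimately have "?J \<subseteq> var_ideal" by (intro genideal_type_minimal[OF id]) auto
    then show ?thesis
      unfolding ideal_radical_type using primeideal_type_power[OF prime] by blast
  qed
  ultimately have "linear_sop (edge_ideal E) k f"
    unfolding linear_sop_def using linear dim by blast
  then have "star_sop E k z f"
    unfolding star_sop_def zero_one_linear_sop_def using coeffs inj_z star by blast
  then show ?thesis unfolding has_star_sop_def by blast
qed

end
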